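(* Let $T_5=\{(x,y)\in\mathbb{N}^2 : x+y\le 6\}$. Then $\mathrm{gon}(R(T_5))=10$.
   Context: $\mathbb{N}=\{1,2,3,\dots\}$. For a Ferrers diagram $F\subset\mathbb{N}^2$, the Ferrers rook graph $R(F)$ is the simple graph with vertex set $F$ in which distinct $(x,y),(x',y')$ are adjacent iff $x=x'$ or $y=y'$. Divisors on a graph: functions $D:V\to\mathbb{Z}$, degree $\sum_v D(v)$; firing a vertex $v$ means $v$ loses $\deg(v)$ chips and each neighbor gains one; divisors are equivalent if related by a sequence of firings; $\vert D\vert$ is the set of effective (nonnegative) divisors equivalent to $D$; $D$ has positive rank if for every vertex $v$ some $D'\in\vert D\vert$ has $D'(v)>0$. The gonality $\mathrm{gon}(G)$ is the minimum degree of a divisor on $G$ with positive rank. *)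

theory Defs
  imports Main
begin

(* A simple graph is given by a finite vertex set V and a symmetric irreflexive
   adjacency relation E (only its restriction to V matters). *)

definition rook_adj :: "nat \<times> nat \<Rightarrow> nat \<times> nat \<Rightarrow> bool" where
  "rook_adj p q \<longleftrightarrow> p \<noteq> q \<and> (fst p = fst q \<or> snd p = snd q)"

(* the staircase Ferrers diagram T_5, with N = {1,2,3,...} *)
definition T5 :: "(nat \<times> nat) set" where
  "T5 = {(x, y). 1 \<le> x \<and> 1 \<le> y \<and> x + y \<le> 6}"

definition vdeg :: "'a set \<Rightarrow> ('a \<Rightarrow> 'a \<Rightarrow> bool) \<Rightarrow> 'a \<Rightarrow> nat" where
  "vdeg V E v = card {w \<in> V. E v w}"

definition is_divisor :: "'a set \<Rightarrow> ('a \<Rightarrow> int) \<Rightarrow> bool" where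
  "is_divisor V D \<longleftrightarrow> (\<forall>u. u \<notin> V \<longrightarrow> D u = 0)"

definition div_degree :: "'a set \<Rightarrow> ('a \<Rightarrow> int) \<Rightarrow> int" where
  "div_degree V D = (\<Sum>v\<in>V. D v)"

definition fire :: "'a set \<Rightarrow> ('a \<Rightarrow> 'a \<Rightarrow> bool) \<Rightarrow> 'a \<Rightarrow> ('a \<Rightarrow> int) \<Rightarrow> ('a \<Rightarrow> int)" where
  "fire V E v D = (\<lambda>u. if u = v then D u - int (vdeg V E v)
                        else if u \<in> V \<and> E v u then D u + 1 else D u)"

definition div_equiv :: "'a set \<Rightarrow> ('a \<Rightarrow> 'a \<Rightarrow> bool) \<Rightarrow> ('a \<Rightarrow> int) \<Rightarrow> ('a \<Rightarrow> int) \<Rightarrow> bool" where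
  "div_equiv V E = (\<lambda>A B. \<exists>v\<in>V. B = fire V E v A)\<^sup>*\<^sup>*"

definition effective :: "'a set \<Rightarrow> ('a \<Rightarrow> int) \<Rightarrow> bool" where
  "effective V D \<longleftrightarrow> (\<forall>v\<in>V. D v \<ge> 0)"

definition positive_rank :: "'a set \<Rightarrow> ('a \<Rightarrow> 'a \<Rightarrow> bool) \<Rightarrow> ('a \<Rightarrow> int) \<Rightarrow> bool" where
  "positive_rank V E D \<longleftrightarrow>
     (\<forall>v\<in>V. \<exists>D'. div_equiv V E D D' \<and> effective V D' \<and> D' v > 0)"

definition gonality :: "'a set \<Rightarrow> ('a \<Rightarrow> 'a \<Rightarrow> bool) \<Rightarrow> int" where
  "gonality V E = (LEAST k::int. \<exists>D. is_divisor V D \<and> div_degree V D = k \<and> positive_rank V E D)"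

end

theory Submission
  imports Defs
begin

text \<open>
  Call a set of vertices legal for an effective divisor if firing it leaves no vertex in debt, and
  let \<open>T\<close> be the staircase with 15 cells. A legal set of a divisor of degree at most 9 has at most 9
  boundary edges, and in the rook graph of \<open>T\<close> such a set, or its complement, has at most 3
  vertices: removing the leftmost column of a set with 4 to 7 cells shows by induction that its
  boundary has at least 10 edges.

  Let \<open>q = (1,1)\<close>. Every class containing an effective divisor contains a \<open>q\<close>-reduced one: each of
  its legal sets contains \<open>q\<close>. If it has degree at most 9 and fewer than 8 chips at \<open>q\<close>, it has no
  legal set with at most 3 vertices; if it has 8 or more, the same is true after firing \<open>q\<close>. In a
  class of positive rank every empty vertex therefore lies outside a legal set missing at most 3
  vertices. This forces at least 4, 3 and 2 chips on the first three columns, and one more on the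
  last two.

  The bound is attained by the divisor with \<open>4, 3, 2, 1, 0\<close> chips on the first column.
\<close>

section \<open>Chip firing on finite simple graphs\<close>

locale simple_graph =
  fixes V :: "'a set" and E :: "'a \<Rightarrow> 'a \<Rightarrow> bool"
  assumes finite_V [simp]: "finite V"
    and sym: "E u v \<Longrightarrow> E v u"
    and irrefl [simp]: "\<not> E v v"
begin

definition degree_into :: "'a set \<Rightarrow> 'a \<Rightarrow> nat" where
  "degree_into B u = card {x \<in> B. E u x}"

definition edges_between :: "'a set \<Rightarrow> 'a set \<Rightarrow> nat" where
  "edges_between A B = (\<Sum>u\<in>A. degree_into B u)"

definition cut_size :: "'a set \<Rightarrow> nat" where
  "cut_size U = edges_between U (V - U)"

definition clique :: "'a set \<Rightarrow> bool" where
  "clique K \<longleftrightarrow> (\<forall>u\<in>K. \<forall>x\<in>K. u \<noteq> x \<longrightarrow> E u x)"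

definition laplacian :: "('a \<Rightarrow> int) \<Rightarrow> 'a \<Rightarrow> int" where
  "laplacian f u = (if u \<in> V then \<Sum>x | x \<in> V \<and> E u x. f x - f u else 0)"

definition fire_set :: "'a set \<Rightarrow> ('a \<Rightarrow> int) \<Rightarrow> 'a \<Rightarrow> int" where
  "fire_set U D u = D u + laplacian (\<lambda>x. of_bool (x \<in> U)) u"

definition legal :: "'a set \<Rightarrow> ('a \<Rightarrow> int) \<Rightarrow> bool" where
  "legal U D \<longleftrightarrow> U \<subseteq> V \<and> U \<noteq> {} \<and> (\<forall>u\<in>U. int (degree_into (V - U) u) \<le> D u)"

text \<open>Reduced divisors are usually required to be effective only away from \<open>q\<close>.\<close>

definition reduced :: "'a \<Rightarrow> ('a \<Rightarrow> int) \<Rightarrow> bool" where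
  "reduced q D \<longleftrightarrow> effective V D \<and> (\<forall>U. legal U D \<longrightarrow> q \<in> U)"

lemma degree_into_empty [simp]: "degree_into {} u = 0"
  by (simp add: degree_into_def)

lemma degree_into_insert [simp]:
  assumes "finite B" "x \<notin> B"
  shows "degree_into (insert x B) u = of_bool (E u x) + degree_into B u"
proof -
  have "{y \<in> insert x B. E u y} = (if E u x then insert x {y \<in> B. E u y} else {y \<in> B. E u y})"
    by auto
  then show ?thesis using assms by (simp add: degree_into_def)
qed

lemma degree_into_Un_disjoint:
  assumes "finite A" "finite B" "A \<inter> B = {}"
  shows "degree_into (A \<union> B) u = degree_into A u + degree_into B u"
proof -
  have "{x \<in> A \<union> B. E u x} = {x \<in> A. E u x} \<union> {x \<in> B. E u x}" by blast
  then show ?thesis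
    using assms by (simp add: degree_into_def) (rule card_Un_disjoint; auto)
qed

lemma legalD: "legal U D \<Longrightarrow> u \<in> U \<Longrightarrow> int (degree_into (V - U) u) \<le> D u"
  by (simp add: legal_def)

lemma legal_complementD:
  assumes "legal (V - Z) D" "Z \<subseteq> V" "u \<in> V - Z"
  shows "int (degree_into Z u) \<le> D u"
  using legalD[OF assms(1,3)] assms(2) by (simp add: double_diff)

lemma legal_subset: "legal U D \<Longrightarrow> U \<subseteq> V"
  by (simp add: legal_def)

lemma laplacian_add:
  "laplacian (\<lambda>x. f x + g x) u = laplacian f u + laplacian g u"
  by (simp add: laplacian_def algebra_simps flip: sum.distrib)

lemma laplacian_diff:
  "laplacian (\<lambda>x. f x - g x) u = laplacian f u - laplacian g u"
  by (auto simp: laplacian_def simp flip: sum_subtractf intro: sum.cong)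

lemma laplacian_const [simp]: "laplacian (\<lambda>_. a) = (\<lambda>_. 0)"
  by (auto simp: laplacian_def)

lemma finite_subset_V: "U \<subseteq> V \<Longrightarrow> finite U"
  using finite_V by (rule rev_finite_subset)

lemma degree_into_Diff:
  assumes "U \<subseteq> V"
  shows "degree_into (V - U) u + degree_into U u = degree_into V u"
  using degree_into_Un_disjoint[of U "V - U" u] assms finite_subset_V[OF assms]
  by (simp add: Un_absorb1)

lemma edges_between_Un_disjoint:
  assumes "finite B" "finite C" "B \<inter> C = {}"
  shows "edges_between A (B \<union> C) = edges_between A B + edges_between A C"
  using assms by (simp add: edges_between_def degree_into_Un_disjoint sum.distrib)

lemma edges_between_commute:
  assumes "finite A" "finite B"
  shows "edges_between A B = edges_between B A"
proof -
  have "edges_between A B = (\<Sum>u\<in>A. \<Sum>x | x \<in> B \<and> E u x. 1)"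
    by (simp add: edges_between_def degree_into_def)
  also have "\<dots> = (\<Sum>x\<in>B. \<Sum>u | u \<in> A \<and> E u x. 1)"
    using assms by (rule sum.swap_restrict)
  also have "\<dots> = (\<Sum>x\<in>B. \<Sum>u | u \<in> A \<and> E x u. 1)"
    using sym by (intro sum.cong) auto
  finally show ?thesis by (simp add: edges_between_def degree_into_def)
qed

lemma cut_size_complement: "U \<subseteq> V \<Longrightarrow> cut_size (V - U) = cut_size U"
  by (simp add: cut_size_def double_diff edges_between_commute finite_subset_V)

lemma cut_size_Un_disjoint:
  assumes "A \<subseteq> V" "B \<subseteq> V" "A \<inter> B = {}"
  shows "cut_size (A \<union> B) + 2 * edges_between A B = cut_size A + cut_size B"
proof -
  let ?R = "V - (A \<union> B)"
  have fin: "finite A" "finite B" "finite ?R" using assms finite_subset_V by auto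
  have compl: "V - A = ?R \<union> B" "V - B = ?R \<union> A" using assms by auto
  have "cut_size A = edges_between A ?R + edges_between A B"
    unfolding cut_size_def compl using fin by (intro edges_between_Un_disjoint) auto
  moreover have "cut_size B = edges_between B ?R + edges_between B A"
    unfolding cut_size_def compl using fin by (intro edges_between_Un_disjoint) auto
  moreover have "cut_size (A \<union> B) = edges_between A ?R + edges_between B ?R"
    unfolding cut_size_def edges_between_def using fin assms(3) by (simp add: sum.union_disjoint)
  ultimately show ?thesis using edges_between_commute[OF fin(1,2)] by simp
qed

lemma cut_size_remove_clique:
  assumes "U \<subseteq> V" "K \<subseteq> U" "clique K"
  shows "cut_size U + card K * (card K - 1) + 2 * edges_between K (U - K) =
    cut_size (U - K) + (\<Sum>u\<in>K. degree_into V u)"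
proof -
  have KV: "K \<subseteq> V" using assms(1,2) by blast
  have "degree_into V u = degree_into (V - K) u + (card K - 1)" if "u \<in> K" for u
  proof -
    have "{x \<in> K. E u x} = K - {u}" using assms(3) that by (auto simp: clique_def)
    then have "degree_into K u = card K - 1"
      using that finite_subset_V[OF KV] by (simp add: degree_into_def)
    then show ?thesis using degree_into_Diff[OF KV] by metis
  qed
  then have "cut_size K + card K * (card K - 1) = (\<Sum>u\<in>K. degree_into V u)"
    by (simp add: cut_size_def edges_between_def sum.distrib)
  moreover have "cut_size U + 2 * edges_between K (U - K) = cut_size K + cut_size (U - K)"
    using cut_size_Un_disjoint[of K "U - K"] KV assms(1,2) by (auto simp: Un_absorb1)
  ultimately show ?thesis by simp
qed

lemma degree_into_complement_ge:
  assumes "U \<subseteq> V" "u \<in> U"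
  shows "degree_into V u \<le> degree_into (V - U) u + (card U - 1)"
proof -
  have fin: "finite U" using assms(1) by (rule finite_subset_V)
  have "degree_into U u \<le> card (U - {u})"
    unfolding degree_into_def using fin by (intro card_mono) auto
  then show ?thesis
    using degree_into_Diff[OF assms(1), of u] assms(2) fin by simp
qed

lemma legal_imp_cut_size_le_degree:
  assumes "legal U D" "effective V D"
  shows "int (cut_size U) \<le> div_degree V D"
proof -
  have "int (cut_size U) \<le> (\<Sum>u\<in>U. D u)"
    unfolding cut_size_def edges_between_def of_nat_sum using assms(1) by (intro sum_mono legalD)
  also have "\<dots> \<le> (\<Sum>u\<in>V. D u)"
    using assms by (intro sum_mono2) (auto simp: legal_def effective_def)
  finally show ?thesis by (simp add: div_degree_def)
qed

lemma legal_imp_clique_degree_ge: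
  assumes "clique K" "K \<subseteq> V" "legal U D" "effective V D"
  shows "int (card (K \<inter> U) * card (K - U)) \<le> (\<Sum>u\<in>K. D u)"
proof -
  have "int (card (K - U)) \<le> D u" if "u \<in> K \<inter> U" for u
  proof -
    have "K - U \<subseteq> {x \<in> V - U. E u x}" using assms(1,2) that by (auto simp: clique_def)
    then have "card (K - U) \<le> degree_into (V - U) u"
      by (simp add: degree_into_def card_mono)
    then show ?thesis using legalD[OF assms(3)] that by fastforce
  qed
  then have "(\<Sum>u\<in>K \<inter> U. int (card (K - U))) \<le> (\<Sum>u\<in>K \<inter> U. D u)"
    by (rule sum_mono)
  also have "\<dots> \<le> (\<Sum>u\<in>K. D u)"
    using assms(2,4) finite_subset_V by (intro sum_mono2) (auto simp: effective_def)
  finally show ?thesis by simp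
qed

lemma laplacian_indicator:
  assumes "u \<in> V" "U \<subseteq> V"
  shows "laplacian (\<lambda>x. of_bool (x \<in> U)) u =
    (if u \<in> U then - int (degree_into (V - U) u) else int (degree_into U u))"
proof (cases "u \<in> U")
  case True
  have "laplacian (\<lambda>x. of_bool (x \<in> U)) u = (\<Sum>x | x \<in> V \<and> E u x. - of_bool (x \<notin> U))"
    unfolding laplacian_def using assms(1) True by (auto intro: sum.cong)
  also have "\<dots> = - int (card ({x \<in> V. E u x} \<inter> {x. x \<notin> U}))"
    by (simp add: sum_negf)
  also have "{x \<in> V. E u x} \<inter> {x. x \<notin> U} = {x \<in> V - U. E u x}" by blast
  finally show ?thesis using True by (simp add: degree_into_def)
next
  case False
  have "{x \<in> V. E u x} \<inter> U = {x \<in> U. E u x}" using assms(2) by blast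
  then show ?thesis using False assms(1) by (simp add: laplacian_def degree_into_def)
qed

lemma fire_set_eq:
  assumes "u \<in> V" "U \<subseteq> V"
  shows "fire_set U D u = D u +
    (if u \<in> U then - int (degree_into (V - U) u) else int (degree_into U u))"
  by (simp only: fire_set_def laplacian_indicator[OF assms])

lemma fire_eq_fire_set:
  assumes "v \<in> V"
  shows "fire V E v D = fire_set {v} D"
proof
  fix u
  show "fire V E v D u = fire_set {v} D u"
  proof (cases "u \<in> V")
    case True
    have "{x \<in> V. E v x} = {x \<in> V - {v}. E v x}" by auto
    then have "vdeg V E v = degree_into (V - {v}) v" by (simp only: vdeg_def degree_into_def)
    then show ?thesis using True assms sym by (auto simp: fire_def fire_set_eq)
  next
    case False
    then show ?thesis using assms by (auto simp: fire_def fire_set_def laplacian_def)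
  qed
qed

lemma div_equiv_imp_laplacian:
  assumes "div_equiv V E D D'"
  obtains f where "\<And>u. D' u = D u + laplacian f u"
proof -
  have "\<exists>f. \<forall>u. D' u = D u + laplacian f u"
    using assms unfolding div_equiv_def
  proof (induction rule: rtranclp_induct)
    case base
    show ?case by (rule exI[of _ "\<lambda>_. 0"]) simp
  next
    case (step A B)
    then obtain f v where "\<forall>u. A u = D u + laplacian f u" "v \<in> V" "B = fire V E v A"
      by blast
    then have "B u = D u + laplacian (\<lambda>x. f x + of_bool (x \<in> {v})) u" for u
      unfolding laplacian_add by (simp add: fire_eq_fire_set fire_set_def)
    then show ?case by blast
  qed
  then show ?thesis using that by blast
qed

lemma div_equiv_trans: "div_equiv V E A B \<Longrightarrow> div_equiv V E B C \<Longrightarrow> div_equiv V E A C"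
  unfolding div_equiv_def by (rule rtranclp_trans)

lemma div_equiv_fire_set:
  assumes "U \<subseteq> V"
  shows "div_equiv V E D (fire_set U D)"
  using finite_subset_V[OF assms] assms
proof (induction U rule: finite_induct)
  case empty
  have "fire_set {} D = D" by (rule ext) (simp add: fire_set_def)
  then show ?case by (simp add: div_equiv_def)
next
  case (insert v U)
  have "(\<lambda>x. of_bool (x \<in> insert v U) :: int) = (\<lambda>x. of_bool (x \<in> U) + of_bool (x \<in> {v}))"
    using insert.hyps by auto
  then have "fire_set (insert v U) D = fire V E v (fire_set U D)"
    using insert.prems by (simp add: fire_eq_fire_set fire_set_def[abs_def] laplacian_add add.assoc)
  then show ?case
    using insert.IH insert.prems unfolding div_equiv_def
    by (auto intro: rtranclp.rtrancl_into_rtrancl)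
qed

lemma laplacian_self_adjoint:
  "(\<Sum>u\<in>V. p u * laplacian f u) = (\<Sum>u\<in>V. f u * laplacian p u)"
proof -
  have "(\<Sum>u\<in>V. \<Sum>x | x \<in> V \<and> E u x. p u * f x) = (\<Sum>x\<in>V. \<Sum>u | u \<in> V \<and> E u x. p u * f x)"
    by (rule sum.swap_restrict) simp_all
  also have "\<dots> = (\<Sum>u\<in>V. \<Sum>x | x \<in> V \<and> E u x. f u * p x)"
    using sym by (intro sum.cong) (auto simp: mult.commute)
  finally show ?thesis
    by (simp add: laplacian_def sum_distrib_left right_diff_distrib sum_subtractf mult_ac)
qed

lemma degree_div_equiv:
  assumes "div_equiv V E D D'"
  shows "div_degree V D' = div_degree V D"
proof -
  obtain f where "\<And>u. D' u = D u + laplacian f u" using assms div_equiv_imp_laplacian by blast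
  then show ?thesis
    using laplacian_self_adjoint[of "\<lambda>_. 1" f] by (simp add: div_degree_def sum.distrib)
qed

lemma effective_fire_set:
  assumes "legal U D" "effective V D"
  shows "effective V (fire_set U D)"
  using assms legalD[OF assms(1)] legal_subset[OF assms(1)]
  by (auto simp: effective_def fire_set_eq)

lemma positive_rank_if_legal:
  assumes "effective V D"
    and "\<And>v. v \<in> V \<Longrightarrow> D v = 0 \<Longrightarrow> \<exists>U. legal U D \<and> v \<notin> U \<and> (\<exists>u\<in>U. E u v)"
  shows "positive_rank V E D"
  unfolding positive_rank_def
proof
  fix v assume v: "v \<in> V"
  show "\<exists>D'. div_equiv V E D D' \<and> effective V D' \<and> 0 < D' v"
  proof (cases "D v = 0")
    case True
    then obtain U u where U: "legal U D" "v \<notin> U" "u \<in> U" "E u v" using assms(2) v by blast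
    have UV: "U \<subseteq> V" using U(1) by (rule legal_subset)
    have "0 < degree_into U v"
      unfolding degree_into_def card_gt_0_iff using U(3,4) sym finite_subset_V[OF UV] by auto
    then have "0 < fire_set U D v"
      using True v UV U(2) by (simp add: fire_set_eq)
    then show ?thesis
      using div_equiv_fire_set[OF UV] effective_fire_set[OF U(1) assms(1)] by blast
  next
    case False
    then have "0 < D v" using assms(1) v by (simp add: effective_def order_less_le)
    then show ?thesis using assms(1) by (auto simp: div_equiv_def)
  qed
qed

lemma laplacian_at_maximum_le:
  assumes "u \<in> V" "\<And>x. x \<in> V \<Longrightarrow> h x \<le> h u"
  shows "laplacian h u \<le> - int (degree_into (V - {x \<in> V. h x = h u}) u)"
proof -
  let ?M = "{x \<in> V. h x = h u}"
  have "laplacian h u \<le> laplacian (\<lambda>x. of_bool (x \<in> ?M)) u"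
    unfolding laplacian_def using assms by (auto intro!: sum_mono simp: order_less_le)
  also have "\<dots> = - int (degree_into (V - ?M) u)"
    using assms(1) by (subst laplacian_indicator) auto
  finally show ?thesis .
qed

text \<open>The firing set is where a script leading from \<open>D'\<close> to a divisor positive at \<open>v\<close> is maximal.
  Vertices of that set lose chips, so \<open>v\<close> is not among them.\<close>

lemma positive_rank_imp_legal:
  assumes "positive_rank V E D" "div_equiv V E D D'" "v \<in> V" "D' v \<le> 0"
  obtains U where "legal U D'" "v \<notin> U"
proof -
  obtain D'' where D'': "div_equiv V E D D''" "effective V D''" "D'' v > 0"
    using assms unfolding positive_rank_def by blast
  obtain f g where f: "\<And>u. D' u = D u + laplacian f u" and g: "\<And>u. D'' u = D u + laplacian g u"
    using assms(2) D''(1) div_equiv_imp_laplacian by metis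
  define h where "h = (\<lambda>x. g x - f x)"
  have h: "D'' u = D' u + laplacian h u" for u
    by (simp add: f g h_def laplacian_diff)
  obtain m where m: "m \<in> V" "h m = Max (h ` V)"
    using Max_in[of "h ` V"] assms(3) by fastforce
  have max: "h x \<le> h m" if "x \<in> V" for x using m that by simp
  define U where "U = {x \<in> V. h x = h m}"
  have loss: "D'' u \<le> D' u - int (degree_into (V - U) u)" if "u \<in> U" for u
    using laplacian_at_maximum_le[of u h] max that h[of u] by (simp add: U_def)
  have "U \<subseteq> V" by (auto simp: U_def)
  then have "int (degree_into (V - U) u) \<le> D' u" if "u \<in> U" for u
    using loss[OF that] that D''(2) by (fastforce simp: effective_def)
  then have "legal U D'" using m \<open>U \<subseteq> V\<close> by (auto simp: legal_def U_def)
  moreover have "v \<notin> U" using loss[of v] D''(3) assms(4) by fastforce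
  ultimately show ?thesis using that by blast
qed

lemma weighted_degree_fire_set:
  assumes "U \<subseteq> V"
  shows "(\<Sum>u\<in>V. p u * fire_set U D u) = (\<Sum>u\<in>V. p u * D u) + (\<Sum>u\<in>U. laplacian p u)"
proof -
  have "(\<Sum>u\<in>V. p u * laplacian (\<lambda>x. of_bool (x \<in> U)) u) = (\<Sum>u\<in>U. laplacian p u)"
    using assms by (simp add: laplacian_self_adjoint[of p] Int_absorb1)
  then show ?thesis by (simp add: fire_set_def distrib_left sum.distrib)
qed

lemma weighted_degree_le:
  assumes "effective V D"
  shows "(\<Sum>u\<in>V. p u * D u) \<le> (\<Sum>u\<in>V. \<bar>p u\<bar>) * div_degree V D"
proof -
  have "p u \<le> (\<Sum>u\<in>V. \<bar>p u\<bar>)" if "u \<in> V" for u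
    using member_le_sum[of u V "\<lambda>u. \<bar>p u\<bar>"] that by fastforce
  then have "(\<Sum>u\<in>V. p u * D u) \<le> (\<Sum>u\<in>V. (\<Sum>u\<in>V. \<bar>p u\<bar>) * D u)"
    using assms by (intro sum_mono mult_right_mono) (auto simp: effective_def)
  then show ?thesis by (simp add: div_degree_def sum_distrib_left)
qed

text \<open>Firing a set that avoids \<open>q\<close> increases the \<open>p\<close>-weighted degree, so its maximisers are
  reduced.\<close>

lemma ex_reduced_if_subharmonic:
  assumes "effective V D" and p: "\<And>u. u \<in> V \<Longrightarrow> u \<noteq> q \<Longrightarrow> 0 < laplacian p u"
  obtains D' where "div_equiv V E D D'" "reduced q D'"
proof -
  define P where "P D' = (\<Sum>u\<in>V. p u * D' u)" for D'
  define B where "B = (\<Sum>u\<in>V. \<bar>p u\<bar>) * div_degree V D"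
  have bound: "P D' \<le> B" if "div_equiv V E D D'" "effective V D'" for D'
    using weighted_degree_le[OF that(2), of p] degree_div_equiv[OF that(1)]
    by (simp add: P_def B_def)
  obtain D' where D': "div_equiv V E D D'" "effective V D'"
    and max: "\<And>D''. div_equiv V E D D'' \<Longrightarrow> effective V D'' \<Longrightarrow> nat (B - P D') \<le> nat (B - P D'')"
    using ex_has_least_nat[of "\<lambda>D'. div_equiv V E D D' \<and> effective V D'" D "\<lambda>D'. nat (B - P D')"]
      assms(1) by (auto simp: div_equiv_def)
  have "q \<in> U" if U: "legal U D'" for U
  proof (rule ccontr)
    assume q: "q \<notin> U"
    have UV: "U \<subseteq> V" using U by (rule legal_subset)
    have "div_equiv V E D (fire_set U D')"
      using D'(1) div_equiv_fire_set[OF UV] by (rule div_equiv_trans)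
    moreover have "effective V (fire_set U D')" using U D'(2) by (rule effective_fire_set)
    ultimately have "P (fire_set U D') \<le> P D'" using max bound by fastforce
    moreover have "0 < (\<Sum>u\<in>U. laplacian p u)"
      using U UV q p finite_subset_V[OF UV] by (intro sum_pos) (auto simp: legal_def)
    ultimately show False using weighted_degree_fire_set[OF UV, of p D'] by (simp add: P_def)
  qed
  then show ?thesis using that D' by (auto simp: reduced_def)
qed

lemma ex_reduced_if_eccentricity_le_2:
  assumes "effective V D" "q \<in> V"
    and near: "\<And>u. u \<in> V \<Longrightarrow> u \<noteq> q \<Longrightarrow> E u q \<or> (\<exists>w\<in>V. E u w \<and> E w q)"
  obtains D' where "div_equiv V E D D'" "reduced q D'"
proof -
  define p where "p u = (if u = q then int (card V) else of_bool (E u q))" for u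
  have "0 < laplacian p u" if u: "u \<in> V" "u \<noteq> q" for u
  proof (cases "E u q")
    case True
    let ?N = "{x \<in> V. E u x}"
    have q: "q \<in> ?N" using True assms(2) by simp
    have "card ?N < card V" using u(1) irrefl by (intro psubset_card_mono finite_V) blast
    moreover have "laplacian p u = p q - p u + (\<Sum>x\<in>?N - {q}. p x - p u)"
      using q u by (simp add: laplacian_def sum.remove)
    moreover have "(\<Sum>x\<in>?N - {q}. - 1) \<le> (\<Sum>x\<in>?N - {q}. p x - p u)"
      using True u by (intro sum_mono) (auto simp: p_def)
    moreover have "card (?N - {q}) = card ?N - 1" "0 < card ?N"
      using q by (auto simp: card_gt_0_iff)
    ultimately show ?thesis using True u(2) by (simp add: p_def)
  next
    case False
    then obtain w where w: "w \<in> V" "E u w" "E w q" using near u by blast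
    have "p w \<le> (\<Sum>x | x \<in> V \<and> E u x. p x)"
      using w by (intro member_le_sum) (auto simp: p_def)
    then show ?thesis using False u w by (auto simp: laplacian_def p_def split: if_splits)
  qed
  then show ?thesis using ex_reduced_if_subharmonic assms(1) that by blast
qed

definition zeros_enclosed :: "nat \<Rightarrow> ('a \<Rightarrow> int) \<Rightarrow> bool" where
  "zeros_enclosed k D \<longleftrightarrow>
     (\<forall>v\<in>V. D v = 0 \<longrightarrow> (\<exists>U. legal U D \<and> v \<notin> U \<and> card (V - U) \<le> k))"

lemma zeros_enclosed_if_no_small_legal:
  assumes "positive_rank V E D" "div_equiv V E D D'" "effective V D'"
    and small_cut: "\<And>U. U \<subseteq> V \<Longrightarrow> int (cut_size U) \<le> div_degree V D \<Longrightarrow> card U \<le> k \<or> card (V - U) \<le> k"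
    and large: "\<And>U. legal U D' \<Longrightarrow> k < card U"
  shows "zeros_enclosed k D'"
  unfolding zeros_enclosed_def
proof (intro ballI impI)
  fix v assume "v \<in> V" "D' v = 0"
  then obtain U where U: "legal U D'" "v \<notin> U"
    using positive_rank_imp_legal[OF assms(1,2)] by (metis order_refl)
  have "int (cut_size U) \<le> div_degree V D"
    using legal_imp_cut_size_le_degree[OF U(1) assms(3)] degree_div_equiv[OF assms(2)] by simp
  then have "card (V - U) \<le> k"
    using small_cut[OF legal_subset[OF U(1)]] large[OF U(1)] by linarith
  then show "\<exists>U. legal U D' \<and> v \<notin> U \<and> card (V - U) \<le> k" using U by blast
qed

lemma zeros_enclosed_imp_clique_degree_ge:
  assumes "zeros_enclosed k D" "effective V D" "clique K" "K \<subseteq> V"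
  shows "int (card K) - 1 \<le> (\<Sum>u\<in>K. D u) \<or>
    (\<exists>U. legal U D \<and> K \<inter> U = {} \<and> card (V - U) \<le> k)"
proof (cases "\<exists>v\<in>K. D v = 0")
  case True
  then obtain v U where v: "v \<in> K" "v \<notin> U" and U: "legal U D" "card (V - U) \<le> k"
    using assms(1,4) unfolding zeros_enclosed_def by blast
  let ?a = "card (K \<inter> U)" and ?b = "card (K - U)"
  have fin: "finite K" using assms(4) by (rule finite_subset_V)
  have ab: "card K = ?a + ?b" using fin card_Int_Diff by blast
  have "0 < ?b" using v fin by (auto simp: card_gt_0_iff)
  show ?thesis
  proof (cases "?a = 0")
    case True
    then show ?thesis using U fin by auto
  next
    case False
    then have "?a + ?b \<le> ?a * ?b + 1"
      using \<open>0 < ?b\<close> by (cases ?a; cases ?b) (auto simp: algebra_simps)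
    then have "int (card K) - 1 \<le> int (?a * ?b)" using ab by linarith
    also have "\<dots> \<le> (\<Sum>u\<in>K. D u)"
      using assms(2-4) U(1) by (intro legal_imp_clique_degree_ge)
    finally show ?thesis ..
  qed
next
  case False
  then have "1 \<le> D u" if "u \<in> K" for u
    using assms(2,4) that by (fastforce simp: effective_def order_less_le)
  then have "int (card K) \<le> (\<Sum>u\<in>K. D u)"
    using sum_mono[of K "\<lambda>_. 1" D] by simp
  then show ?thesis by simp
qed

lemma zeros_enclosed_imp_large_clique_degree_ge:
  assumes "zeros_enclosed k D" "effective V D" "clique K" "K \<subseteq> V" "k < card K"
  shows "int (card K) - 1 \<le> (\<Sum>u\<in>K. D u)"
proof -
  have "k < card (V - U)" if "K \<inter> U = {}" for U
    using assms(4,5) that card_mono[of "V - U" K] by fastforce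
  then show ?thesis
    using zeros_enclosed_imp_clique_degree_ge[OF assms(1-4)] by (meson linorder_not_le)
qed

lemma zero_star_imp_legal_complement:
  assumes "zeros_enclosed k D" "k \<le> card Z" "Z \<subseteq> V" "a \<in> Z"
    and zero: "\<And>x. x \<in> Z \<Longrightarrow> D x = 0"
    and star: "\<And>x. x \<in> Z \<Longrightarrow> x \<noteq> a \<Longrightarrow> E x a"
  shows "legal (V - Z) D"
proof -
  obtain U where U: "legal U D" "a \<notin> U" "card (V - U) \<le> k"
    using assms(1,3,4) zero unfolding zeros_enclosed_def by blast
  have "x \<notin> U" if "x \<in> Z" for x
  proof
    assume x: "x \<in> U"
    then have "a \<in> {y \<in> V - U. E x y}" using U(2) star that assms(3,4) by auto
    then have "0 < degree_into (V - U) x"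
      unfolding degree_into_def card_gt_0_iff by auto
    then show False using legalD[OF U(1) x] zero[OF that] by simp
  qed
  then have "Z \<subseteq> V - U" using assms(3) by blast
  then have "Z = V - U" using U(3) assms(2) by (intro card_seteq) auto
  then have "V - Z = U" using legal_subset[OF U(1)] by blast
  then show ?thesis using U(1) by simp
qed

end

section \<open>Boundaries in staircase rook graphs\<close>

definition staircase :: "nat \<Rightarrow> (nat \<times> nat) set" where
  "staircase n = {(x, y). 1 \<le> x \<and> 1 \<le> y \<and> x + y \<le> n + 1}"

definition slack :: "nat \<Rightarrow> nat \<times> nat \<Rightarrow> nat" where
  "slack n u = n + 1 - (fst u + snd u)"

lemma finite_staircase: "finite (staircase n)"
  by (rule finite_subset[of _ "{..n} \<times> {..n}"]) (auto simp: staircase_def)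

interpretation staircase: simple_graph "staircase n" rook_adj for n
  by unfold_locales (auto simp: finite_staircase rook_adj_def)

lemma clique_column: "\<forall>u\<in>K. fst u = c \<Longrightarrow> staircase.clique K"
  by (simp add: staircase.clique_def rook_adj_def)

lemma degree_staircase:
  assumes "u \<in> staircase n"
  shows "staircase.degree_into (staircase n) u = n - 1 + slack n u"
proof -
  obtain x y where u: "u = (x, y)" by (cases u)
  then have xy: "1 \<le> x" "1 \<le> y" "x + y \<le> n + 1" using assms by (auto simp: staircase_def)
  let ?C = "{x} \<times> ({1..n + 1 - x} - {y})" and ?R = "({1..n + 1 - y} - {x}) \<times> {y}"
  have "{v \<in> staircase n. rook_adj u v} = ?C \<union> ?R"
    using xy by (auto simp: u rook_adj_def staircase_def)
  moreover have "card (?C \<union> ?R) = card ?C + card ?R"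
    by (rule card_Un_disjoint) auto
  moreover have "card ?C = n - x" "card ?R = n - y"
    using xy by (simp_all add: card_cartesian_product)
  ultimately show ?thesis using xy by (simp add: staircase.degree_into_def slack_def u)
qed

lemma slack_le: "u \<in> staircase n \<Longrightarrow> slack n u \<le> n - 1"
  by (auto simp: staircase_def slack_def)

lemma card_times_pred_le_sum:
  fixes A :: "nat set"
  assumes "finite A"
  shows "card A * (card A - 1) \<le> 2 * \<Sum>A"
  using assms
proof (induction A rule: finite_linorder_max_induct)
  case (insert b A)
  have "card A \<le> card {..<b}" using insert.hyps by (intro card_mono) auto
  then show ?case
    using insert by (cases "card A") (auto simp: algebra_simps)
qed simp

lemma column_slack_ge:
  assumes "C \<subseteq> staircase n" "\<forall>u\<in>C. fst u = c"
  shows "card C * (card C - 1) \<le> 2 * (\<Sum>u\<in>C. slack n u)"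
proof -
  have inj: "inj_on (slack n) C"
  proof (rule inj_onI)
    fix u v assume "u \<in> C" "v \<in> C" "slack n u = slack n v"
    moreover from this have "u \<in> staircase n" "v \<in> staircase n" "fst u = fst v"
      using assms by auto
    ultimately show "u = v" by (cases u; cases v) (auto simp: staircase_def slack_def)
  qed
  have "finite C" using assms(1) by (rule staircase.finite_subset_V)
  then show ?thesis
    using card_times_pred_le_sum[of "slack n ` C"] inj by (simp add: card_image sum.reindex)
qed

lemma degree_into_right_le_slack:
  assumes "U \<subseteq> staircase n" "\<forall>x\<in>U. fst u < fst x"
  shows "staircase.degree_into U u \<le> slack n u"
proof -
  have "{x \<in> U. rook_adj u x} \<subseteq> {fst u<..n + 1 - snd u} \<times> {snd u}"
    using assms by (fastforce simp: rook_adj_def staircase_def)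
  then have "staircase.degree_into U u \<le> card ({fst u<..n + 1 - snd u} \<times> {snd u})"
    unfolding staircase.degree_into_def by (intro card_mono) auto
  then show ?thesis by (simp add: slack_def)
qed

lemma edges_between_column_le:
  assumes "\<forall>u\<in>C. fst u = c" "\<forall>x\<in>U. fst x \<noteq> c"
  shows "staircase.edges_between U C \<le> card U"
proof -
  have "staircase.degree_into C x \<le> 1" if "x \<in> U" for x
  proof -
    have "{u \<in> C. rook_adj x u} \<subseteq> {(c, snd x)}"
      using assms that by (auto simp: rook_adj_def)
    then show ?thesis
      unfolding staircase.degree_into_def using card_mono[of "{(c, snd x)}"] by fastforce
  qed
  then show ?thesis
    unfolding staircase.edges_between_def
    using sum_bounded_above[of U "staircase.degree_into C" 1] by simp
qed

lemma card_column_le: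
  assumes "C \<subseteq> staircase n" "\<forall>u\<in>C. fst u = c"
  shows "card C \<le> n"
proof -
  have "C \<subseteq> {c} \<times> {1..n}" using assms by (force simp: staircase_def)
  then show ?thesis using card_mono[of "{c} \<times> {1..n}" C] by simp
qed

lemma cut_size_remove_leftmost_column:
  assumes U: "U \<subseteq> staircase n" "\<forall>u\<in>U. c \<le> fst u" and C: "C = {u \<in> U. fst u = c}"
  obtains S B where
    "staircase.cut_size n U + card C * (card C - 1) + 2 * B =
      staircase.cut_size n (U - C) + (n - 1) * card C + S"
    "card C * (card C - 1) \<le> 2 * S" "B \<le> S" "B \<le> card (U - C)" "B \<le> (n - 1) * card C"
proof
  let ?S = "\<Sum>u\<in>C. slack n u" and ?B = "staircase.edges_between C (U - C)"
  have column: "\<forall>u\<in>C. fst u = c" and apart: "\<forall>x\<in>U - C. fst x \<noteq> c" by (simp_all add: C)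
  have CU: "C \<subseteq> U" and CV: "C \<subseteq> staircase n" "U - C \<subseteq> staircase n" using U C by auto
  have fin: "finite C" "finite (U - C)" using CV staircase.finite_subset_V by auto
  have "(\<Sum>u\<in>C. staircase.degree_into (staircase n) u) = (\<Sum>u\<in>C. n - 1 + slack n u)"
    using CV(1) by (intro sum.cong degree_staircase) auto
  then show "staircase.cut_size n U + card C * (card C - 1) + 2 * ?B =
      staircase.cut_size n (U - C) + (n - 1) * card C + ?S"
    using staircase.cut_size_remove_clique[OF U(1) CU clique_column[OF column]]
    by (simp add: sum.distrib mult.commute)
  show "card C * (card C - 1) \<le> 2 * ?S"
    using CV(1) column by (rule column_slack_ge)
  show "?B \<le> ?S"
    unfolding staircase.edges_between_def using U(2) CV column apart
    by (intro sum_mono degree_into_right_le_slack) (auto simp: order_less_le)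
  also have "?S \<le> (n - 1) * card C"
    using sum_bounded_above[of C "slack n" "n - 1"] slack_le CV(1) by (auto simp: mult.commute)
  finally show "?B \<le> (n - 1) * card C" .
  show "?B \<le> card (U - C)"
    using edges_between_column_le[OF column apart] fin
    by (simp add: staircase.edges_between_commute)
qed

text \<open>\<open>t (9 - t) / 2\<close> is the boundary of the topmost \<open>t\<close> cells of the first column, for
  \<open>t \<le> 5\<close>; the value \<open>10\<close> at \<open>t = 4\<close> persists up to seven cells.\<close>

lemma staircase_5_cut_size_ge:
  assumes "U \<subseteq> staircase 5" "card U \<le> 7"
  shows "min 4 (card U) * (9 - min 4 (card U)) \<le> 2 * staircase.cut_size 5 U"
  using assms
proof (induction "card U" arbitrary: U rule: less_induct)
  case less
  show ?case
  proof (cases "U = {}")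
    case False
    have fin: "finite U" using less.prems(1) by (rule staircase.finite_subset_V)
    define c where "c = Min (fst ` U)"
    define C where "C = {u \<in> U. fst u = c}"
    have leftmost: "\<forall>u\<in>U. c \<le> fst u" using fin by (simp add: c_def)
    obtain S B where
      cut: "staircase.cut_size 5 U + card C * (card C - 1) + 2 * B =
        staircase.cut_size 5 (U - C) + (5 - 1) * card C + S"
      and bounds: "card C * (card C - 1) \<le> 2 * S" "B \<le> S" "B \<le> card (U - C)" "B \<le> (5 - 1) * card C"
      using cut_size_remove_leftmost_column[OF less.prems(1) leftmost C_def] by metis
    have card: "card U = card C + card (U - C)"
      using card_Int_Diff[OF fin, of C] by (simp add: C_def Int_def conj_commute)
    have "c \<in> fst ` U" using False fin by (simp add: c_def)
    then have "0 < card C" using fin by (auto simp: C_def card_gt_0_iff)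
    moreover have "card C \<le> 5"
      using less.prems(1) by (intro card_column_le[of _ _ c]) (auto simp: C_def)
    ultimately have "card C \<in> {1, 2, 3, 4, 5}" "card (U - C) \<in> {0, 1, 2, 3, 4, 5, 6}"
      using card less.prems(2) by auto
    moreover have "min 4 (card (U - C)) * (9 - min 4 (card (U - C)))
        \<le> 2 * staircase.cut_size 5 (U - C)"
      using less.prems card \<open>0 < card C\<close> by (intro less.hyps) auto
    ultimately show ?thesis
      using cut bounds card less.prems(2) by (elim insertE emptyE) simp_all
  qed simp
qed

lemma staircase_eq_Sigma: "staircase n = (SIGMA x:{1..n}. {1..n + 1 - x})"
  by (auto simp: staircase_def)

lemma staircase_5: "staircase 5 = {(1,1), (1,2), (1,3), (1,4), (1,5), (2,1), (2,2), (2,3), (2,4),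
    (3,1), (3,2), (3,3), (4,1), (4,2), (5,1)}"
  unfolding staircase_eq_Sigma by code_simp

lemma card_staircase_5: "card (staircase 5) = 15"
  by (simp add: staircase_5)

lemma staircase_5_small_cut:
  assumes "U \<subseteq> staircase 5" "staircase.cut_size 5 U \<le> 9"
  shows "card U \<le> 3 \<or> card (staircase 5 - U) \<le> 3"
proof (rule ccontr)
  assume contra: "\<not> ?thesis"
  have large: "10 \<le> staircase.cut_size 5 W"
    if "W \<subseteq> staircase 5" "3 < card W" "card W \<le> 7" for W
    using staircase_5_cut_size_ge[OF that(1,3)] that(2) by (simp add: min_def)
  have "card U + card (staircase 5 - U) = 15"
    using assms(1) staircase.finite_subset_V[OF assms(1)] card_mono[OF finite_staircase assms(1)]
    by (simp add: card_Diff_subset card_staircase_5)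
  then consider "card U \<le> 7" | "card (staircase 5 - U) \<le> 7" by linarith
  then have "10 \<le> staircase.cut_size 5 U"
  proof cases
    case 1
    then show ?thesis using large assms(1) contra by simp
  next
    case 2
    then show ?thesis
      using large[of "staircase 5 - U"] contra staircase.cut_size_complement[OF assms(1)] by simp
  qed
  then show False using assms(2) by simp
qed

section \<open>The lower bound\<close>

lemma card_vimage_swap: "card (prod.swap -` A) = card A"
  by (rule card_vimage_inj) auto

lemma legal_transpose:
  assumes "staircase.legal n U D"
  shows "staircase.legal n (prod.swap -` U) (D \<circ> prod.swap)"
proof -
  have "staircase.degree_into (staircase n - prod.swap -` U) u
      = staircase.degree_into (staircase n - U) (prod.swap u)" for u
  proof -
    have "{v \<in> staircase n - prod.swap -` U. rook_adj u v}
        = prod.swap -` {v \<in> staircase n - U. rook_adj (prod.swap u) v}"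
      by (cases u) (auto simp: staircase_def rook_adj_def)
    then show ?thesis by (simp only: staircase.degree_into_def card_vimage_swap)
  qed
  moreover have "prod.swap -` U \<noteq> {}"
    using assms by (simp add: staircase.legal_def surj_vimage_empty)
  moreover have "prod.swap -` U \<subseteq> staircase n"
    using staircase.legal_subset[OF assms] by (auto simp: staircase_def)
  ultimately show ?thesis using staircase.legalD[OF assms] by (simp add: staircase.legal_def)
qed

lemma zeros_enclosed_transpose:
  assumes "staircase.zeros_enclosed n k D"
  shows "staircase.zeros_enclosed n k (D \<circ> prod.swap)"
  unfolding staircase.zeros_enclosed_def
proof (intro ballI impI)
  fix v assume "v \<in> staircase n" "(D \<circ> prod.swap) v = 0"
  then have "prod.swap v \<in> staircase n" "D (prod.swap v) = 0" by (auto simp: staircase_def)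
  then obtain U where U: "staircase.legal n U D" "prod.swap v \<notin> U"
    "card (staircase n - U) \<le> k"
    using assms unfolding staircase.zeros_enclosed_def by blast
  have "staircase n - prod.swap -` U = prod.swap -` (staircase n - U)"
    by (auto simp: staircase_def)
  then have "card (staircase n - prod.swap -` U) \<le> k"
    using U(3) by (simp add: card_vimage_swap)
  then show "\<exists>U. staircase.legal n U (D \<circ> prod.swap) \<and> v \<notin> U \<and> card (staircase n - U) \<le> k"
    using legal_transpose[OF U(1)] U(2) by (intro exI[of _ "prod.swap -` U"]) simp
qed

lemma div_degree_staircase_5:
  "div_degree (staircase 5) D = D (1,1) + D (1,2) + D (1,3) + D (1,4) + D (1,5)
    + D (2,1) + D (2,2) + D (2,3) + D (2,4)
    + D (3,1) + D (3,2) + D (3,3) + D (4,1) + D (4,2) + D (5,1)"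
  by (simp add: div_degree_def staircase_5)

lemma effective_staircase_5:
  "effective (staircase 5) D \<longleftrightarrow> 0 \<le> D (1,1) \<and> 0 \<le> D (1,2) \<and> 0 \<le> D (1,3) \<and> 0 \<le> D (1,4) \<and> 0 \<le> D (1,5)
    \<and> 0 \<le> D (2,1) \<and> 0 \<le> D (2,2) \<and> 0 \<le> D (2,3) \<and> 0 \<le> D (2,4)
    \<and> 0 \<le> D (3,1) \<and> 0 \<le> D (3,2) \<and> 0 \<le> D (3,3) \<and> 0 \<le> D (4,1) \<and> 0 \<le> D (4,2) \<and> 0 \<le> D (5,1)"
  by (simp add: effective_def staircase_5)

lemma empty_corner_imp_degree_ge:
  assumes enc: "staircase.zeros_enclosed 5 3 D" and eff: "effective (staircase 5) D"
    and zero: "D (4,1) = 0" "D (4,2) = 0" "D (5,1) = 0"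
  shows "10 \<le> div_degree (staircase 5) D"
proof (rule ccontr)
  assume contra: "\<not> ?thesis"
  let ?Z = "{(4,1), (4,2), (5,1)} :: (nat \<times> nat) set"
  have Z: "?Z \<subseteq> staircase 5" by (simp add: staircase_5)
  have "staircase.legal 5 (staircase 5 - ?Z) D"
    using enc zero Z
    by (intro staircase.zero_star_imp_legal_complement[where a = "(4,1)" and k = 3])
      (auto simp: rook_adj_def)
  note demand_Z = staircase.legal_complementD[OF this Z]
  have ge: "2 \<le> D (1,1)" "2 \<le> D (2,1)" "2 \<le> D (3,1)" "1 \<le> D (1,2)" "1 \<le> D (2,2)" "1 \<le> D (3,2)"
    using demand_Z[of "(1,1)"] demand_Z[of "(2,1)"] demand_Z[of "(3,1)"]
      demand_Z[of "(1,2)"] demand_Z[of "(2,2)"] demand_Z[of "(3,2)"]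
    by (simp_all add: staircase_5 rook_adj_def)
  let ?Y = "{(1,3), (1,4), (1,5)} :: (nat \<times> nat) set"
  have Y: "?Y \<subseteq> staircase 5" by (simp add: staircase_5)
  have "D (1,3) = 0" "D (1,4) = 0" "D (1,5) = 0"
    using ge contra eff unfolding div_degree_staircase_5 effective_staircase_5 by linarith+
  then have "staircase.legal 5 (staircase 5 - ?Y) D"
    using enc Y
    by (intro staircase.zero_star_imp_legal_complement[where a = "(1,3)" and k = 3])
      (auto simp: rook_adj_def)
  from staircase.legal_complementD[OF this Y, of "(1,1)"] have "3 \<le> D (1,1)"
    by (simp add: staircase_5 rook_adj_def)
  then show False
    using ge contra eff unfolding div_degree_staircase_5 effective_staircase_5 by linarith
qed

lemma third_column_degree_ge:
  assumes enc: "staircase.zeros_enclosed 5 3 D" and eff: "effective (staircase 5) D"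
    and "div_degree (staircase 5) D < 10"
  shows "2 \<le> D (3,1) + D (3,2) + D (3,3)"
proof (rule ccontr)
  let ?K = "{(3,1), (3,2), (3,3)} :: (nat \<times> nat) set"
  assume contra: "\<not> ?thesis"
  then obtain U where U: "staircase.legal 5 U D" "?K \<inter> U = {}" "card (staircase 5 - U) \<le> 3"
    using staircase.zeros_enclosed_imp_clique_degree_ge[OF enc eff clique_column[of ?K 3]]
    by (auto simp: staircase_5)
  have K: "?K \<subseteq> staircase 5" by (simp add: staircase_5)
  have "?K = staircase 5 - U"
    using U(2,3) K by (intro card_seteq) auto
  then have "staircase.legal 5 (staircase 5 - ?K) D"
    using U(1) staircase.legal_subset[OF U(1)] by (simp add: double_diff)
  note demand = staircase.legal_complementD[OF this K]
  have ge: "1 \<le> D (1,1)" "1 \<le> D (1,2)" "1 \<le> D (1,3)" "1 \<le> D (2,1)" "1 \<le> D (2,2)" "1 \<le> D (2,3)"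
    "1 \<le> D (4,1)" "1 \<le> D (4,2)" "1 \<le> D (5,1)"
    using demand[of "(1,1)"] demand[of "(1,2)"] demand[of "(1,3)"] demand[of "(2,1)"]
      demand[of "(2,2)"] demand[of "(2,3)"] demand[of "(4,1)"] demand[of "(4,2)"] demand[of "(5,1)"]
    by (simp_all add: staircase_5 rook_adj_def)
  have "D (1,4) = 0" "D (2,4) = 0" "D (1,5) = 0"
    using ge assms(3) eff unfolding div_degree_staircase_5 effective_staircase_5 by linarith+
  then have "10 \<le> div_degree (staircase 5) (D \<circ> prod.swap)"
    using eff zeros_enclosed_transpose[OF enc]
    by (intro empty_corner_imp_degree_ge) (auto simp: effective_staircase_5)
  then show False using assms(3) by (simp add: div_degree_staircase_5)
qed

lemma zeros_enclosed_imp_degree_ge: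
  assumes enc: "staircase.zeros_enclosed 5 3 D" and eff: "effective (staircase 5) D"
  shows "10 \<le> div_degree (staircase 5) D"
proof (rule ccontr)
  assume contra: "\<not> ?thesis"
  note large = staircase.zeros_enclosed_imp_large_clique_degree_ge[OF enc eff clique_column]
  have "4 \<le> D (1,1) + D (1,2) + D (1,3) + D (1,4) + D (1,5)"
    using large[of "{(1,1), (1,2), (1,3), (1,4), (1,5)}" 1] by (simp add: staircase_5)
  moreover have "3 \<le> D (2,1) + D (2,2) + D (2,3) + D (2,4)"
    using large[of "{(2,1), (2,2), (2,3), (2,4)}" 2] by (simp add: staircase_5)
  moreover have "2 \<le> D (3,1) + D (3,2) + D (3,3)"
    using enc eff contra by (intro third_column_degree_ge) auto
  ultimately have "D (4,1) = 0" "D (4,2) = 0" "D (5,1) = 0"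
    using contra eff unfolding div_degree_staircase_5 effective_staircase_5 by linarith+
  then show False using empty_corner_imp_degree_ge[OF enc eff] contra by simp
qed

lemma outdegree_staircase_ge:
  assumes "U \<subseteq> staircase n" "u \<in> U"
  shows "n - 1 + slack n u \<le> staircase.degree_into (staircase n - U) u + (card U - 1)"
  using staircase.degree_into_complement_ge[OF assms] degree_staircase assms by (metis subsetD)

lemma corner_subset: "{(1,1)} \<subseteq> staircase 5"
  by (simp add: staircase_def)

lemma corner_outdegree: "staircase.degree_into (staircase 5 - {(1,1)}) (1,1) = 8"
  by (simp add: staircase_5 rook_adj_def)

lemma card_legal_gt_3_if_corner_lt_8:
  assumes "staircase.reduced 5 (1,1) D" "div_degree (staircase 5) D < 10" "D (1,1) < 8"
    and "staircase.legal 5 U D"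
  shows "3 < card U"
proof (rule ccontr)
  assume small: "\<not> 3 < card U"
  let ?out = "staircase.degree_into (staircase 5 - U)"
  have UV: "U \<subseteq> staircase 5" and q: "(1,1) \<in> U"
    using assms(1,4) by (auto simp: staircase.reduced_def staircase.legal_def)
  have fin: "finite U" using UV by (rule staircase.finite_subset_V)
  have "0 < card U" using q fin by (auto simp: card_gt_0_iff)
  have corner: "9 - card U \<le> ?out (1,1)"
    using outdegree_staircase_ge[OF UV q] \<open>0 < card U\<close> by (simp add: slack_def)
  have others: "5 - card U \<le> ?out u" if "u \<in> U" for u
    using outdegree_staircase_ge[OF UV that] \<open>0 < card U\<close> by simp
  have "(card U - 1) * (5 - card U) = (\<Sum>u\<in>U - {(1,1)}. 5 - card U)"
    using q fin by simp
  also have "\<dots> \<le> (\<Sum>u\<in>U - {(1,1)}. ?out u)"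
    using others by (intro sum_mono) simp
  finally have "?out (1,1) + (card U - 1) * (5 - card U) \<le> staircase.cut_size 5 U"
    using q fin by (simp add: staircase.cut_size_def staircase.edges_between_def sum.remove)
  moreover have "staircase.cut_size 5 U < 10"
    using staircase.legal_imp_cut_size_le_degree[OF assms(4)] assms(1,2)
    by (simp add: staircase.reduced_def)
  moreover have "?out (1,1) < 8" using staircase.legalD[OF assms(4) q] assms(3) by simp
  moreover have "card U = 1 \<or> card U = 2 \<or> card U = 3" using small \<open>0 < card U\<close> by linarith
  ultimately show False using corner by auto
qed

lemma card_legal_gt_3_after_firing_corner:
  assumes "effective (staircase 5) D" "div_degree (staircase 5) D < 10" "8 \<le> D (1,1)"
    and "staircase.legal 5 U (staircase.fire_set 5 {(1,1)} D)"
  shows "3 < card U"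
proof (rule ccontr)
  assume small: "\<not> 3 < card U"
  define R where "R = D((1,1) := D (1,1) - 8)"
  have UV: "U \<subseteq> staircase 5" "U \<noteq> {}" using assms(4) by (auto simp: staircase.legal_def)
  have fin: "finite U" using UV(1) by (rule staircase.finite_subset_V)
  have R: "0 \<le> R u" if "u \<in> staircase 5" for u
    using assms(1,3) that by (simp add: R_def effective_def)
  have "div_degree (staircase 5) R = div_degree (staircase 5) D - 8"
    by (simp add: R_def div_degree_staircase_5)
  then have "(\<Sum>u\<in>staircase 5. R u) \<le> 1" using assms(2) by (simp add: div_degree_def)
  have "4 - int (card U) \<le> R u" if u: "u \<in> U" for u
  proof -
    have "u \<in> staircase 5" using u UV(1) by blast
    then have "staircase.fire_set 5 {(1,1)} D u \<le> R u + 1"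
      by (simp add: staircase.fire_set_eq[OF _ corner_subset] corner_outdegree R_def
          del: One_nat_def)
    moreover have "0 < card U" using u fin by (auto simp: card_gt_0_iff)
    ultimately show ?thesis
      using outdegree_staircase_ge[OF UV(1) u] staircase.legalD[OF assms(4) u] by simp
  qed
  then have "(\<Sum>u\<in>U. 4 - int (card U)) \<le> (\<Sum>u\<in>U. R u)" by (rule sum_mono)
  also have "\<dots> \<le> (\<Sum>u\<in>staircase 5. R u)"
    using UV(1) R by (intro sum_mono2) (auto simp: finite_staircase)
  also have "\<dots> \<le> 1" by fact
  finally have "int (card U) * (4 - int (card U)) \<le> 1" by simp
  moreover have "0 < card U" using UV(2) fin by (simp add: card_gt_0_iff)
  then have "card U = 1 \<or> card U = 2 \<or> card U = 3" using small by linarith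
  ultimately show False by auto
qed

lemma adjacent_or_common_neighbour_corner:
  assumes "u \<in> staircase n" "u \<noteq> (1,1)"
  shows "rook_adj u (1,1) \<or> (\<exists>w\<in>staircase n. rook_adj u w \<and> rook_adj w (1,1))"
proof (cases "fst u = 1 \<or> snd u = 1")
  case True
  then show ?thesis using assms(2) by (auto simp: rook_adj_def)
next
  case False
  then have "(1, snd u) \<in> staircase n" "rook_adj u (1, snd u)" "rook_adj (1, snd u) (1,1)"
    using assms(1) by (auto simp: rook_adj_def staircase_def)
  then show ?thesis by blast
qed

lemma ex_equiv_without_small_legal:
  assumes "effective (staircase 5) D" "div_degree (staircase 5) D < 10"
  obtains D' where "div_equiv (staircase 5) rook_adj D D'" "effective (staircase 5) D'"
    "\<And>U. staircase.legal 5 U D' \<Longrightarrow> 3 < card U"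
proof -
  obtain D1 where D1: "div_equiv (staircase 5) rook_adj D D1" "staircase.reduced 5 (1,1) D1"
    using staircase.ex_reduced_if_eccentricity_le_2[OF assms(1)] corner_subset
      adjacent_or_common_neighbour_corner[of _ 5] by blast
  have deg: "div_degree (staircase 5) D1 < 10"
    using staircase.degree_div_equiv[OF D1(1)] assms(2) by simp
  have eff: "effective (staircase 5) D1" using D1(2) by (simp add: staircase.reduced_def)
  show ?thesis
  proof (cases "D1 (1,1) < 8")
    case True
    then show ?thesis using that[OF D1(1) eff] card_legal_gt_3_if_corner_lt_8[OF D1(2) deg] by blast
  next
    case False
    let ?D2 = "staircase.fire_set 5 {(1,1)} D1"
    have "div_equiv (staircase 5) rook_adj D ?D2"
      using D1(1) staircase.div_equiv_fire_set[OF corner_subset] by (rule staircase.div_equiv_trans)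
    moreover have "staircase.legal 5 {(1,1)} D1"
      using False corner_subset by (simp add: staircase.legal_def corner_outdegree del: One_nat_def)
    then have "effective (staircase 5) ?D2" using eff by (rule staircase.effective_fire_set)
    ultimately show ?thesis
      using that card_legal_gt_3_after_firing_corner[OF eff deg] False by force
  qed
qed

lemma positive_rank_degree_ge:
  assumes "positive_rank (staircase 5) rook_adj D"
  shows "10 \<le> div_degree (staircase 5) D"
proof (rule ccontr)
  assume contra: "\<not> ?thesis"
  obtain D0 where D0: "div_equiv (staircase 5) rook_adj D D0" "effective (staircase 5) D0"
    using assms corner_subset unfolding positive_rank_def by blast
  have deg0: "div_degree (staircase 5) D0 < 10"
    using staircase.degree_div_equiv[OF D0(1)] contra by simp
  obtain D' where D': "div_equiv (staircase 5) rook_adj D0 D'" "effective (staircase 5) D'"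
    "\<And>U. staircase.legal 5 U D' \<Longrightarrow> 3 < card U"
    using ex_equiv_without_small_legal[OF D0(2) deg0] by blast
  have eq: "div_equiv (staircase 5) rook_adj D D'"
    using D0(1) D'(1) by (rule staircase.div_equiv_trans)
  have "staircase.zeros_enclosed 5 3 D'"
  proof (rule staircase.zeros_enclosed_if_no_small_legal[OF assms eq D'(2)])
    fix U assume "U \<subseteq> staircase 5" "int (staircase.cut_size 5 U) \<le> div_degree (staircase 5) D"
    then show "card U \<le> 3 \<or> card (staircase 5 - U) \<le> 3"
      using contra by (intro staircase_5_small_cut) auto
  qed (fact D'(3))
  then show False
    using zeros_enclosed_imp_degree_ge D'(2) staircase.degree_div_equiv[OF eq] contra by fastforce
qed

section \<open>The staircase divisor\<close>

definition staircase_divisor :: "nat \<Rightarrow> nat \<times> nat \<Rightarrow> int" where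
  "staircase_divisor n u = (if u \<in> staircase n \<and> fst u = 1 then int (n - snd u) else 0)"

lemma is_divisor_staircase_divisor: "is_divisor (staircase n) (staircase_divisor n)"
  by (simp add: is_divisor_def staircase_divisor_def)

lemma degree_staircase_divisor: "div_degree (staircase n) (staircase_divisor n) = int (n choose 2)"
proof -
  have "div_degree (staircase n) (staircase_divisor n) = (\<Sum>u\<in>{1::nat} \<times> {1..n}. int (n - snd u))"
    unfolding div_degree_def
    using finite_staircase[of n]
    by (intro sum.mono_neutral_cong_right) (auto simp: staircase_def staircase_divisor_def)
  also have "\<dots> = (\<Sum>y\<in>{1..n}. int (n - y))"
    by (simp add: sum.cartesian_product')
  also have "\<dots> = (\<Sum>i\<in>{..<n}. int i)"
    by (rule sum.reindex_bij_witness[of _ "\<lambda>i. n - i" "\<lambda>y. n - y"]) auto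
  also have "\<dots> = int (n choose 2)"
    by (induction n) (simp_all add: numeral_2_eq_2)
  finally show ?thesis .
qed

lemma legal_first_column:
  assumes "1 \<le> n"
  shows "staircase.legal n {u \<in> staircase n. fst u = 1} (staircase_divisor n)"
  unfolding staircase.legal_def
proof (intro conjI ballI)
  let ?C = "{u \<in> staircase n. fst u = 1}"
  show "?C \<noteq> {}" using assms by (auto simp: staircase_def intro: exI[of _ 1])
  fix u assume u: "u \<in> ?C"
  have "{v \<in> staircase n - ?C. rook_adj u v} \<subseteq> {1<..n + 1 - snd u} \<times> {snd u}"
    using u by (auto simp: staircase_def rook_adj_def)
  then have "staircase.degree_into (staircase n - ?C) u \<le> card ({1<..n + 1 - snd u} \<times> {snd u})"
    unfolding staircase.degree_into_def by (intro card_mono) auto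
  then show "int (staircase.degree_into (staircase n - ?C) u) \<le> staircase_divisor n u"
    using u by (simp add: staircase_divisor_def)
qed auto

lemma legal_remove_top:
  assumes "2 \<le> n"
  shows "staircase.legal n (staircase n - {(1,n)}) (staircase_divisor n)"
  unfolding staircase.legal_def
proof (intro conjI ballI)
  have "(1,1) \<in> staircase n - {(1,n)}" using assms by (auto simp: staircase_def)
  then show "staircase n - {(1,n)} \<noteq> {}" by blast
  fix u assume u: "u \<in> staircase n - {(1,n)}"
  have "staircase n - (staircase n - {(1,n)}) = {(1,n)}" using assms by (auto simp: staircase_def)
  moreover have "of_bool (rook_adj u (1,n)) \<le> staircase_divisor n u"
    using u by (cases u) (auto simp: staircase_divisor_def staircase_def rook_adj_def)
  ultimately show "int (staircase.degree_into (staircase n - (staircase n - {(1,n)})) u)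
      \<le> staircase_divisor n u"
    by simp
qed auto

lemma positive_rank_staircase_divisor:
  assumes "2 \<le> n"
  shows "positive_rank (staircase n) rook_adj (staircase_divisor n)"
proof (rule staircase.positive_rank_if_legal)
  fix v assume v: "v \<in> staircase n" "staircase_divisor n v = 0"
  show "\<exists>U. staircase.legal n U (staircase_divisor n) \<and> v \<notin> U \<and> (\<exists>u\<in>U. rook_adj u v)"
  proof (cases "fst v = 1")
    case True
    then have "v = (1,n)" using v by (cases v) (auto simp: staircase_divisor_def staircase_def)
    moreover have "(1,1) \<in> staircase n - {(1,n)}" "rook_adj (1,1) (1,n)"
      using assms by (auto simp: staircase_def rook_adj_def)
    ultimately show ?thesis using legal_remove_top[OF assms] by blast
  next
    case False
    then have "(1, snd v) \<in> {u \<in> staircase n. fst u = 1}" "rook_adj (1, snd v) v"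
      using v(1) by (auto simp: staircase_def rook_adj_def)
    then show ?thesis using legal_first_column[of n] assms False by force
  qed
qed (simp add: effective_def staircase_divisor_def)

theorem theorem4p5:
  shows "gonality T5 rook_adj = 10"
proof -
  have T5: "T5 = staircase 5" by (auto simp: T5_def staircase_def)
  have "div_degree (staircase 5) (staircase_divisor 5) = 10"
    by (simp add: degree_staircase_divisor choose_two)
  then show ?thesis
    unfolding gonality_def T5
    using is_divisor_staircase_divisor positive_rank_staircase_divisor[of 5] positive_rank_degree_ge
    by (intro Least_equality) auto
qed

end
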